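(* Let $\mathcal{X}$ be a complete separable metric space equipped with its Borel sigma-field. Let $\mathcal{F}$ be a bounded, countable family of Borel measurable functions $f : \mathcal{X} \to \mathbb{R}$. If $\mathcal{F}$ is a VC-graph class, then for every stationary ergodic process $\mathbf{X} = X_1, X_2, \ldots$ with values in $\mathcal{X}$, $$\sup_{f \in \mathcal{F}} \left| \frac{1}{m} \sum_{i=1}^m f(X_i) - E f(X) \right| \to 0 \quad \text{with probability one as } m \to \infty.$$
   Context: $X$ denotes a random variable with the same distribution as $X_1$ (independent of $\mathbf{X}$). A stationary process is ergodic if its invariant sigma-field is trivial. The family $\mathcal{F}$ is bounded if there is a constant $M < \infty$ with $|f(x)| \leq M$ for all $x \in \mathcal{X}$ and $f \in \mathcal{F}$. VC dimension: for a collection $\mathcal{C}$ of subsets of a set $\mathcal{Z}$ and a finite set $D \subseteq \mathcal{Z}$, let $S(D : \mathcal{C}) = |\{ C \cap D : C \in \mathcal{C} \}|$. The VC dimension $\dim(\mathcal{C})$ is the largest integer $k \geq 1$ such that $S(D : \mathcal{C}) = 2^k$ for some $k$-element subset $D$ of $\mathcal{Z}$ (taken to be $0$ if no such $k$ exists); if for every $k \geq 1$ there is a $k$-element set $D$ with $S(D : \mathcal{C}) = 2^k$, then $\dim(\mathcal{C}) = +\infty$. VC-graph class: the graph of $f : \mathcal{X} \to \mathbb{R}$ is the set $G_f \subseteq \mathcal{X} \times \mathbb{R}$ given by $G_f = \{ (x,s) : 0 \leq s \leq f(x) \text{ or } f(x) \leq s \leq 0 \}$. The family $\mathcal{F}$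 is a VC-graph class if $\dim( \{ G_f : f \in \mathcal{F} \} )$, the VC dimension of a family of subsets of $\mathcal{X} \times \mathbb{R}$, is finite. *)

theory Defs
  imports "HOL-Probability.Probability"
begin

definition trace_count :: "'z set \<Rightarrow> 'z set set \<Rightarrow> nat" where
  "trace_count D \<C> = card ((\<lambda>C. C \<inter> D) ` \<C>)"

definition shatters_some :: "'z set set \<Rightarrow> nat \<Rightarrow> bool" where
  "shatters_some \<C> k \<longleftrightarrow> (\<exists>D. finite D \<and> card D = k \<and> trace_count D \<C> = 2 ^ k)"

text \<open>
  Subsets of a shattered set are shattered, so if \<open>shatters_some \<C> k\<close> fails for one
  \<open>k \<ge> 1\<close>, it fails for all larger \<open>k\<close>, and the \<open>GREATEST\<close> below is a genuine maximum.
\<close>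

definition vc_dim :: "'z set set \<Rightarrow> enat" where
  "vc_dim \<C> =
    (if \<forall>k\<ge>1. shatters_some \<C> k then \<infinity>
     else if \<exists>k\<ge>1. shatters_some \<C> k then enat (GREATEST k. k \<ge> 1 \<and> shatters_some \<C> k)
     else 0)"

definition fun_graph :: "('a \<Rightarrow> real) \<Rightarrow> ('a \<times> real) set" where
  "fun_graph f = {(x, s). (0 \<le> s \<and> s \<le> f x) \<or> (f x \<le> s \<and> s \<le> 0)}"

definition vc_graph_class :: "('a \<Rightarrow> real) set \<Rightarrow> bool" where
  "vc_graph_class F \<longleftrightarrow> vc_dim (fun_graph ` F) < \<infinity>"

definition bounded_family :: "('a \<Rightarrow> real) set \<Rightarrow> bool" where
  "bounded_family F \<longleftrightarrow> (\<exists>M. \<forall>f\<in>F. \<forall>x. \<bar>f x\<bar> \<le> M)"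

text \<open>
  Processes are indexed from \<open>0\<close>: \<open>X i\<close> stands for the random variable $X_{i+1}$.
\<close>

definition path_space :: "(nat \<Rightarrow> 'a::topological_space) measure" where
  "path_space = (\<Pi>\<^sub>M i\<in>UNIV. borel)"

definition path_shift :: "(nat \<Rightarrow> 'a) \<Rightarrow> nat \<Rightarrow> 'a" where
  "path_shift x = (\<lambda>i. x (Suc i))"

definition process_law ::
    "'w measure \<Rightarrow> (nat \<Rightarrow> 'w \<Rightarrow> 'a::topological_space) \<Rightarrow> (nat \<Rightarrow> 'a) measure" where
  "process_law M X = distr M path_space (\<lambda>\<omega> i. X i \<omega>)"

definition stationary_process ::
    "'w measure \<Rightarrow> (nat \<Rightarrow> 'w \<Rightarrow> 'a::topological_space) \<Rightarrow> bool" where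
  "stationary_process M X \<longleftrightarrow>
    (\<forall>i. X i \<in> borel_measurable M) \<and> process_law M (\<lambda>i. X (Suc i)) = process_law M X"

definition invariant_sets :: "(nat \<Rightarrow> 'a::topological_space) set set" where
  "invariant_sets = {A \<in> sets path_space. path_shift -` A = A}"

definition ergodic_process ::
    "'w measure \<Rightarrow> (nat \<Rightarrow> 'w \<Rightarrow> 'a::topological_space) \<Rightarrow> bool" where
  "ergodic_process M X \<longleftrightarrow>
    (\<forall>A\<in>invariant_sets. measure (process_law M X) A = 0 \<or> measure (process_law M X) A = 1)"

end

theory Submission
  imports Defs
begin

text \<open>
  For a fixed level \<open>s \<noteq> 0\<close> the sections \<open>{x. (x, s) \<in> fun_graph f}\<close> form a VC class of sets, and
  every \<open>f\<close> is uniformly within \<open>d\<close> of a fixed linear combination of the indicators of its sections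
  at the levels \<open>\<plusminus>j * d\<close>; so it suffices to treat a countable VC class \<open>\<C>\<close> of sets.

  For such a class and every \<open>\<eta> > 0\<close> there is a finite measurable cover of the space such that, for
  every \<open>C \<in> \<C>\<close>, the cells which \<open>C\<close> cuts into two non-null parts have a union of probability
  \<open>< \<eta>\<close>. Hence every \<open>C\<close> lies, up to null sets, between two unions of cells of nearly equal
  probability, and the pointwise ergodic theorem for these finitely many unions gives the uniform
  law. If there were no such cover, take an ultrafilter on \<open>\<C>\<close> which for each cover contains the
  family of those \<open>C\<close> that have a boundary of probability \<open>\<ge> \<eta>\<close>. There is then a non-null
  \<open>G\<close> each of whose non-null subsets is cut by ultrafilter-most \<open>C\<close>. Cutting the atoms in \<open>G\<close>
  of the sets chosen so far all at once, one obtains arbitrarily many Boolean independent members of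
  \<open>\<C>\<close>, contradicting finite VC dimension.
\<close>

section \<open>The pointwise ergodic theorem for bounded functions\<close>

definition orbit_sum :: "('a \<Rightarrow> 'a) \<Rightarrow> ('a \<Rightarrow> real) \<Rightarrow> nat \<Rightarrow> 'a \<Rightarrow> real" where
  "orbit_sum T f n x = (\<Sum>i<n. f ((T ^^ i) x))"

text \<open>The recursion computes the maximum of \<open>orbit_sum T f k x\<close> over
  \<open>0 \<le> k \<le> n\<close>: the term \<open>0\<close> is the empty sum, and every longer sum
  splits off \<open>f x\<close> and continues from \<open>T x\<close>.\<close>

primrec max_orbit_sum :: "('a \<Rightarrow> 'a) \<Rightarrow> ('a \<Rightarrow> real) \<Rightarrow> nat \<Rightarrow> 'a \<Rightarrow> real" where
  "max_orbit_sum T f 0 x = 0"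
| "max_orbit_sum T f (Suc n) x = max 0 (f x + max_orbit_sum T f n (T x))"

lemma orbit_sum_Suc: "orbit_sum T f (Suc n) x = f x + orbit_sum T f n (T x)"
  unfolding orbit_sum_def sum.lessThan_Suc_shift by (simp add: funpow_swap1)

lemma max_orbit_sum_nonneg: "0 \<le> max_orbit_sum T f n x"
  by (cases n) auto

lemma max_orbit_sum_mono: "max_orbit_sum T f n x \<le> max_orbit_sum T f (Suc n) x"
proof (induction n arbitrary: x)
  case (Suc n)
  show ?case using Suc[of "T x"] unfolding max_orbit_sum.simps(2) by (intro max.mono) auto
qed simp

lemma orbit_sum_le_max: "k \<le> n \<Longrightarrow> orbit_sum T f k x \<le> max_orbit_sum T f n x"
proof (induction n arbitrary: k x)
  case 0
  then show ?case by (simp add: orbit_sum_def)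
next
  case (Suc n)
  show ?case
  proof (cases k)
    case 0
    then show ?thesis using max_orbit_sum_nonneg[of T f "Suc n" x] by (simp add: orbit_sum_def)
  next
    case (Suc j)
    with Suc.prems have "orbit_sum T f j (T x) \<le> max_orbit_sum T f n (T x)"
      by (intro Suc.IH) simp
    then show ?thesis by (simp add: Suc orbit_sum_Suc)
  qed
qed

text \<open>Where the running maximum \<open>?m n\<close> is positive, \<open>f\<close> dominates
  \<open>?m n x - ?m n (T x)\<close>; elsewhere this difference is at most \<open>0\<close>. Its
  integral vanishes because \<open>T\<close> preserves the measure, so \<open>f\<close> has
  nonnegative integral over \<open>{0 < ?m n}\<close>. By \<open>pos\<close> these sets grow to
  almost the whole space.\<close>

lemma (in prob_space) maximal_ergodic:
  fixes f :: "'a \<Rightarrow> real"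
  assumes T[measurable]: "T \<in> measurable M M" and inv: "distr M M T = M"
    and f: "integrable M f"
    and pos: "AE x in M. \<exists>n. 0 < orbit_sum T f n x"
  shows "0 \<le> expectation f"
proof -
  note [measurable] = borel_measurable_integrable[OF f]
  let ?m = "max_orbit_sum T f"
  have comp: "integrable M (\<lambda>x. g (T x))" "expectation (\<lambda>x. g (T x)) = expectation g"
    if "integrable M g" for g :: "'a \<Rightarrow> real"
    using that integrable_distr_eq[of T M M g] integral_distr[of T M M g]
    by (auto simp: inv borel_measurable_integrable)
  have m: "integrable M (?m n)" for n
  proof (induction n)
    case 0
    then show ?case by simp
  next
    case (Suc n)
    then show ?case using f comp by simp
  qed
  note [measurable] = borel_measurable_integrable[OF m]
  define I where "I n x = indicator {x\<in>space M. 0 < ?m n x} x * f x" for n x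
  have I: "integrable M (I n)" for n
    unfolding I_def using f by (intro integrable_mult_indicator[where 'b=real, simplified]) measurable
  have I_nonneg: "0 \<le> expectation (I n)" for n
  proof -
    \<comment> \<open>Garsia's inequality\<close>
    have "?m n x - ?m n (T x) \<le> I n x" if "x \<in> space M" for x
    proof (cases "0 < ?m n x")
      case True
      then obtain k where k: "n = Suc k" by (cases n) auto
      have "?m n x = f x + ?m k (T x)" using True k by (auto simp: max_def split: if_splits)
      also have "\<dots> \<le> f x + ?m n (T x)" unfolding k by (intro add_left_mono max_orbit_sum_mono)
      finally show ?thesis using True that by (simp add: I_def)
    next
      case False
      then show ?thesis
        using max_orbit_sum_nonneg[of T f n x] max_orbit_sum_nonneg[of T f n "T x"]
        by (simp add: I_def)
    qed
    then have "expectation (\<lambda>x. ?m n x - ?m n (T x)) \<le> expectation (I n)"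
      using m comp(1)[OF m] I by (intro integral_mono) auto
    then show ?thesis using m comp[OF m] by simp
  qed
  have "(\<lambda>n. expectation (I n)) \<longlonglongrightarrow> expectation f"
  proof (rule integral_dominated_convergence)
    show "AE x in M. (\<lambda>n. I n x) \<longlonglongrightarrow> f x"
      using pos AE_space
    proof eventually_elim
      case (elim x)
      then obtain k where k: "0 < orbit_sum T f k x" by blast
      have "I n x = f x" if "k \<le> n" for n
        using orbit_sum_le_max[OF that, of T f x] k elim(2) by (simp add: I_def)
      then show ?case
        by (intro tendsto_eventually) (auto simp: eventually_sequentially)
    qed
    show "integrable M (\<lambda>x. \<bar>f x\<bar>)" using f by simp
  qed (use I f in \<open>auto simp: I_def indicator_def\<close>)
  then show ?thesis by (rule LIMSEQ_le_const) (use I_nonneg in auto)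
qed

text \<open>The limsup of the averages is invariant under \<open>T\<close>, so by ergodicity it
  exceeds \<open>c\<close> almost surely or almost never. In the first case almost every point has a
  positive orbit sum of \<open>f - c\<close>, and the maximal inequality would give
  \<open>c \<le> expectation f\<close>.\<close>

lemma (in prob_space) ergodic_limsup_le:
  fixes f :: "'a \<Rightarrow> real"
  assumes T[measurable]: "T \<in> measurable M M" and inv: "distr M M T = M"
    and erg: "\<And>A. A \<in> sets M \<Longrightarrow> T -` A \<inter> space M = A \<Longrightarrow> prob A = 0 \<or> prob A = 1"
    and f[measurable]: "f \<in> borel_measurable M" and bdd: "\<And>x. \<bar>f x\<bar> \<le> B"
    and c: "expectation f < c"
  shows "AE x in M. limsup (\<lambda>n. ereal (orbit_sum T f n x / n)) \<le> ereal c"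
proof -
  let ?L = "\<lambda>x. limsup (\<lambda>n. ereal (orbit_sum T f n x / n))"
  have [measurable]: "T ^^ i \<in> measurable M M" for i by measurable
  have [measurable]: "orbit_sum T f n \<in> borel_measurable M" for n
    unfolding orbit_sum_def[abs_def] by measurable
  have f_int: "integrable M f"
    using bdd by (intro integrable_const_bound[of _ B]) auto
  define E where "E = {x\<in>space M. ereal c < ?L x}"
  have E[measurable]: "E \<in> sets M" unfolding E_def by measurable
  have L_inv: "?L (T x) = ?L x" for x
  proof -
    \<comment> \<open>Starting the orbit one step later drops \<open>f x\<close> and adds
      \<open>f ((T ^^ n) x)\<close>, a bounded change that is negligible after division by
      \<open>n\<close>.\<close>
    have "(\<lambda>n. (f ((T ^^ n) x) - f x) / n) \<longlonglongrightarrow> 0"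
    proof (rule Lim_null_comparison)
      show "\<forall>\<^sub>F n in sequentially. norm ((f ((T ^^ n) x) - f x) / n) \<le> 2 * B / real n"
      proof (rule always_eventually, rule allI)
        fix n
        have "\<bar>f ((T ^^ n) x) - f x\<bar> \<le> 2 * B" using bdd[of "(T ^^ n) x"] bdd[of x] by linarith
        then show "norm ((f ((T ^^ n) x) - f x) / n) \<le> 2 * B / real n"
          by (simp add: divide_right_mono)
      qed
      show "(\<lambda>n. 2 * B / real n) \<longlonglongrightarrow> 0" by (rule lim_const_over_n)
    qed
    then have lim: "(\<lambda>n. ereal ((f ((T ^^ n) x) - f x) / n)) \<longlonglongrightarrow> 0"
      by (simp add: zero_ereal_def)
    have "orbit_sum T f n (T x) = (f ((T ^^ n) x) - f x) + orbit_sum T f n x" for n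
      using orbit_sum_Suc[of T f n x] by (simp add: orbit_sum_def)
    then have eq: "ereal (orbit_sum T f n (T x) / n) =
        ereal ((f ((T ^^ n) x) - f x) / n) + ereal (orbit_sum T f n x / n)" for n
      by (simp add: add_divide_distrib)
    have "?L (T x) = 0 + ?L x"
      unfolding eq by (rule ereal_limsup_lim_add[OF lim]) simp
    then show ?thesis by simp
  qed
  have "T -` E \<inter> space M = E"
    using measurable_space[OF T] by (auto simp: E_def L_inv)
  then have "prob E = 0 \<or> prob E = 1" using erg E by blast
  moreover have "prob E \<noteq> 1"
  proof
    assume "prob E = 1"
    then have "AE x in M. x \<in> E" using E by (subst (asm) prob_eq_1) auto
    then have "AE x in M. \<exists>n. 0 < orbit_sum T (\<lambda>x. f x - c) n x"
    proof eventually_elim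
      case (elim x)
      show ?case
      proof (rule ccontr)
        assume "\<not> ?thesis"
        then have le: "orbit_sum T (\<lambda>x. f x - c) n x \<le> 0" for n by (simp add: not_less)
        have "\<forall>\<^sub>F n in sequentially. ereal (orbit_sum T f n x / n) \<le> ereal c"
          using eventually_gt_at_top[of 0]
        proof eventually_elim
          case (elim n)
          then show ?case using le[of n] by (simp add: orbit_sum_def sum_subtractf field_simps)
        qed
        then have "?L x \<le> ereal c" by (rule Limsup_bounded)
        with elim show False by (simp add: E_def not_less[symmetric])
      qed
    qed
    then have "0 \<le> expectation (\<lambda>x. f x - c)"
      by (intro maximal_ergodic[OF T inv]) (use f_int in auto)
    then show False using c f_int by (simp add: prob_space)
  qed
  ultimately have "AE x in M. x \<notin> E" using E by (subst (asm) (1) prob_eq_0) auto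
  then show ?thesis using AE_space by eventually_elim (auto simp: E_def not_less)
qed

text \<open>The limsup bound, at the levels \<open>1 / Suc k\<close> above the mean, is applied to
  \<open>f\<close> and to \<open>- f\<close>; the latter bounds the liminf of the averages of
  \<open>f\<close> from below.\<close>

theorem (in prob_space) birkhoff_ergodic_bounded:
  fixes f :: "'a \<Rightarrow> real"
  assumes T: "T \<in> measurable M M" and inv: "distr M M T = M"
    and erg: "\<And>A. A \<in> sets M \<Longrightarrow> T -` A \<inter> space M = A \<Longrightarrow> prob A = 0 \<or> prob A = 1"
    and f[measurable]: "f \<in> borel_measurable M" and bdd: "\<And>x. \<bar>f x\<bar> \<le> B"
  shows "AE x in M. (\<lambda>n. (\<Sum>i<n. f ((T ^^ i) x)) / n) \<longlonglongrightarrow> expectation f"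
proof -
  let ?A = "\<lambda>f n x. orbit_sum T f n x / real n"
  have "AE x in M. \<forall>k. limsup (\<lambda>n. ereal (?A g n x)) \<le> ereal (expectation g + 1 / Suc k)"
    if "g \<in> borel_measurable M" "\<And>x. \<bar>g x\<bar> \<le> B" for g
    using that by (subst AE_all_countable)
      (intro allI ergodic_limsup_le[OF T inv erg], auto)
  from this[of f] this[of "\<lambda>x. - f x"]
  have "AE x in M. \<forall>k. limsup (\<lambda>n. ereal (?A f n x)) \<le> ereal (expectation f + 1 / Suc k)"
    "AE x in M. \<forall>k. limsup (\<lambda>n. ereal (?A (\<lambda>x. - f x) n x)) \<le> ereal (- expectation f + 1 / Suc k)"
    using bdd by auto
  then show ?thesis
  proof eventually_elim
    case (elim x)
    have ev: "\<forall>\<^sub>F n in sequentially. a n < e + \<epsilon>"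
      if "\<And>k. limsup (\<lambda>n. ereal (a n)) \<le> ereal (e + 1 / Suc k)" "0 < \<epsilon>" for a e \<epsilon>
    proof -
      obtain k where "1 / Suc k < \<epsilon>" using \<open>0 < \<epsilon>\<close> nat_approx_posE by blast
      then have "ereal (e + 1 / Suc k) < ereal (e + \<epsilon>)" by simp
      with that(1)[of k] have "limsup (\<lambda>n. ereal (a n)) < ereal (e + \<epsilon>)" by (rule le_less_trans)
      then show ?thesis by (auto dest: Limsup_lessD)
    qed
    have neg: "?A (\<lambda>x. - f x) n x = - ?A f n x" for n
      by (simp add: orbit_sum_def sum_negf)
    have "(\<lambda>n. ?A f n x) \<longlonglongrightarrow> expectation f"
    proof (rule tendstoI)
      fix \<epsilon> :: real assume "0 < \<epsilon>"
      from ev[OF elim(1)[rule_format] this] ev[OF elim(2)[rule_format] this]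
      show "\<forall>\<^sub>F n in sequentially. dist (?A f n x) (expectation f) < \<epsilon>"
        unfolding neg by eventually_elim (simp add: dist_real_def)
    qed
    then show ?case by (simp add: orbit_sum_def)
  qed
qed

section \<open>Finite covers with small boundaries\<close>

lemma ultrafilter_exists:
  fixes F :: "'a filter"
  assumes "F \<noteq> bot"
  obtains U where "U \<le> F" "U \<noteq> bot"
    "\<And>P. eventually P U \<or> eventually (\<lambda>x. \<not> P x) U"
proof -
  define A where "A = {G. G \<le> F \<and> G \<noteq> bot}"
  \<comment> \<open>Finer filters are smaller, so the order is reversed: a Zorn-maximal element is a
    minimal proper filter below \<open>F\<close>.\<close>
  define R :: "'a filter \<Rightarrow> 'a filter \<Rightarrow> bool" where "R = (\<lambda>a b. b \<le> a)"
  have "\<exists>m \<in> A. \<forall>a \<in> A. R m a \<longrightarrow> a = m"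
  proof (rule predicate_Zorn)
    show "partial_order_on A (relation_of R A)"
      by (rule partial_order_on_relation_ofI) (auto simp: R_def)
    fix C assume C: "C \<in> Chains (relation_of R A)"
    then have CA: "C \<subseteq> A" and ch: "\<And>a b. a \<in> C \<Longrightarrow> b \<in> C \<Longrightarrow> a \<le> b \<or> b \<le> a"
      by (auto simp: Chains_def relation_of_def R_def)
    show "\<exists>u \<in> A. \<forall>a \<in> C. R a u"
    proof (cases "C = {}")
      case True
      then show ?thesis using assms by (auto simp: A_def)
    next
      case False
      have ev: "eventually P (Inf C) \<longleftrightarrow> (\<exists>b\<in>C. eventually P b)" for P
        using False ch by (intro eventually_Inf_base) (auto simp: le_inf_iff)
      have "Inf C \<noteq> bot"
        using ev[of "\<lambda>_. False"] CA by (auto simp: A_def trivial_limit_def)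
      moreover have "Inf C \<le> F"
      proof -
        obtain a where "a \<in> C" using False by blast
        moreover from this have "a \<le> F" using CA by (auto simp: A_def)
        ultimately show ?thesis by (rule Inf_lower2)
      qed
      ultimately have "Inf C \<in> A" by (simp add: A_def)
      then show ?thesis by (rule bexI[rotated]) (simp add: R_def Inf_lower)
    qed
  qed
  then obtain U where U: "U \<le> F" "U \<noteq> bot"
    and max: "\<And>G. G \<le> F \<Longrightarrow> G \<noteq> bot \<Longrightarrow> G \<le> U \<Longrightarrow> G = U"
    by (auto simp: A_def R_def)
  have "eventually P U \<or> eventually (\<lambda>x. \<not> P x) U" for P
  proof (rule disjCI)
    assume n: "\<not> eventually (\<lambda>x. \<not> P x) U"
    \<comment> \<open>Adjoining \<open>{x. P x}\<close> keeps the filter proper, so by minimality of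
      \<open>U\<close> it adds nothing.\<close>
    define G where "G = inf U (principal {x. P x})"
    have "G \<noteq> bot"
      using n by (simp add: G_def trivial_limit_def eventually_inf_principal)
    moreover have "G \<le> U" by (simp add: G_def)
    ultimately have "G = U" using U(1) by (intro max) auto
    moreover have "eventually P G" by (simp add: G_def eventually_inf_principal)
    ultimately show "eventually P U" by simp
  qed
  with U show ?thesis by (rule that)
qed

section \<open>Splitting and boundaries\<close>

definition splits :: "'a measure \<Rightarrow> 'a set \<Rightarrow> 'a set \<Rightarrow> bool" where
  "splits M C A \<longleftrightarrow> 0 < measure M (A \<inter> C) \<and> 0 < measure M (A - C)"

definition boundary :: "'a measure \<Rightarrow> 'a set set \<Rightarrow> 'a set \<Rightarrow> 'a set" where
  "boundary M P C = \<Union>{A\<in>P. splits M C A}"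

text \<open>Cells may overlap. Thus any finite list of events together with the complement of its
  union is admissible, and pairwise intersections give common refinements.\<close>

definition finite_covers :: "'a measure \<Rightarrow> 'a set set set" where
  "finite_covers M = {P. finite P \<and> P \<subseteq> sets M \<and> \<Union>P = space M}"

lemma boundary_sets: "P \<in> finite_covers M \<Longrightarrow> boundary M P C \<in> sets M"
  by (auto simp: boundary_def finite_covers_def intro!: sets.finite_Union)

lemma (in finite_measure) splits_mono:
  assumes "splits M C A" "A \<subseteq> B" "B \<in> sets M" "C \<in> sets M"
  shows "splits M C B"
proof -
  have "measure M (A \<inter> C) \<le> measure M (B \<inter> C)" "measure M (A - C) \<le> measure M (B - C)"
    using assms by (auto intro!: finite_measure_mono)
  with assms(1) show ?thesis by (auto simp: splits_def)
qed

section \<open>Shattering and dual shattering\<close>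

lemma trace_count_eqI:
  assumes "\<And>E. E \<subseteq> D \<Longrightarrow> \<exists>C\<in>\<C>. C \<inter> D = E" "finite D"
  shows "trace_count D \<C> = 2 ^ card D"
proof -
  have "(\<lambda>C. C \<inter> D) ` \<C> = Pow D"
  proof
    show "Pow D \<subseteq> (\<lambda>C. C \<inter> D) ` \<C>"
    proof
      fix E assume "E \<in> Pow D"
      then obtain C where "C \<in> \<C>" "C \<inter> D = E" using assms(1) by blast
      then show "E \<in> (\<lambda>C. C \<inter> D) ` \<C>" by (intro image_eqI[of _ _ C]) simp_all
    qed
  qed auto
  then show ?thesis by (simp add: trace_count_def card_Pow assms(2))
qed

lemma trace_count_eqD:
  assumes "trace_count D \<C> = 2 ^ card D" "finite D" "E \<subseteq> D"
  shows "\<exists>C\<in>\<C>. C \<inter> D = E"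
proof -
  have "(\<lambda>C. C \<inter> D) ` \<C> = Pow D"
  proof (rule card_subset_eq)
    show "finite (Pow D)" using assms by simp
    show "card ((\<lambda>C. C \<inter> D) ` \<C>) = card (Pow D)"
      using assms by (simp add: trace_count_def card_Pow)
  qed auto
  then have "E \<in> (\<lambda>C. C \<inter> D) ` \<C>" using assms(3) by simp
  then show ?thesis by auto
qed

text \<open>Dual shattering: the \<open>2 ^ k\<close> sets are indexed by the subsets \<open>S\<close> of \<open>{..<k}\<close>, and the
  \<open>i\<close>-th of the \<open>k\<close> shattered points is put into the set with index \<open>S\<close> iff \<open>i \<in> S\<close>.\<close>

lemma shatters_some_if_independent:
  fixes c :: "nat \<Rightarrow> 'a set"
  assumes C: "\<And>j. j < 2 ^ k \<Longrightarrow> c j \<in> \<C>"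
    and ne: "\<And>J. J \<subseteq> {..<2 ^ k} \<Longrightarrow> \<exists>x. \<forall>j<2 ^ k. x \<in> c j \<longleftrightarrow> j \<in> J"
  shows "shatters_some \<C> k"
proof -
  obtain e where e: "bij_betw e (Pow {..<k}) {..<2 ^ k :: nat}"
    using finite_same_card_bij[of "Pow {..<k}" "{..<2 ^ k :: nat}"]
    by (auto simp: card_Pow)
  have e_lt: "e S < 2 ^ k" if "S \<subseteq> {..<k}" for S
    using e that by (auto simp: bij_betw_def)
  have "\<exists>x. \<forall>j<2 ^ k. x \<in> c j \<longleftrightarrow> j \<in> e ` {S. S \<subseteq> {..<k} \<and> i \<in> S}" for i
    using e_lt by (intro ne) auto
  then obtain x where x: "\<And>i j. j < 2 ^ k \<Longrightarrow> x i \<in> c j \<longleftrightarrow> j \<in> e ` {S. S \<subseteq> {..<k} \<and> i \<in> S}"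
    by metis
  have xe: "x i \<in> c (e S) \<longleftrightarrow> i \<in> S" if "S \<subseteq> {..<k}" for i S
  proof -
    have "e S \<in> e ` {S. S \<subseteq> {..<k} \<and> i \<in> S} \<longleftrightarrow> i \<in> S"
      using that e by (auto simp: bij_betw_def inj_on_def)
    then show ?thesis using x e_lt that by simp
  qed
  \<comment> \<open>The set with index \<open>{i}\<close> contains \<open>x i\<close> and no other
    \<open>x j\<close>, so the points are distinct.\<close>
  have inj: "inj_on x {..<k}"
  proof (rule inj_onI)
    fix i j assume ij: "i \<in> {..<k}" "j \<in> {..<k}" "x i = x j"
    then have "x i \<in> c (e {i})" by (subst xe) auto
    then have "x j \<in> c (e {i})" by (simp only: ij(3))
    then show "i = j" using ij(1) by (subst (asm) xe) auto
  qed
  have "trace_count (x ` {..<k}) \<C> = 2 ^ card (x ` {..<k})"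
  proof (rule trace_count_eqI)
    fix E assume "E \<subseteq> x ` {..<k}"
    then obtain S where S: "S \<subseteq> {..<k}" "E = x ` S" by (meson subset_imageE)
    show "\<exists>C\<in>\<C>. C \<inter> x ` {..<k} = E"
    proof (rule bexI)
      show "c (e S) \<inter> x ` {..<k} = E" using S(1) xe[OF S(1)] unfolding S(2) by blast
    qed (rule C[OF e_lt[OF S(1)]])
  qed auto
  with inj show ?thesis
    unfolding shatters_some_def by (intro exI[of _ "x ` {..<k}"]) (simp add: card_image)
qed

section \<open>Covers with small boundaries\<close>

lemma (in prob_space) uniformly_split_set:
  assumes U: "U \<noteq> bot" "\<And>P. eventually P U \<or> eventually (\<lambda>x. \<not> P x) U"
    and bd: "\<And>P. P \<in> finite_covers M \<Longrightarrow>
      eventually (\<lambda>C. \<eta> \<le> prob (boundary M P C)) U"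
    and "0 < \<eta>"
  obtains G where "G \<in> sets M" "0 < prob G"
    "\<And>B. B \<in> sets M \<Longrightarrow> B \<subseteq> G \<Longrightarrow> 0 < prob B \<Longrightarrow> eventually (\<lambda>C. splits M C B) U"
proof -
  \<comment> \<open>\<open>\<Union>S\<close> exhausts, up to null sets, the events that \<open>U\<close>-most \<open>C\<close> do not split.
    In a cover consisting of finitely many such events and the rest, the boundary of \<open>U\<close>-most \<open>C\<close>
    lies in the rest, which therefore keeps probability \<open>\<ge> \<eta>\<close>.\<close>
  define N where "N = {B \<in> sets M. eventually (\<lambda>C. \<not> splits M C B) U}"
  define W where "W = {\<S>. countable \<S> \<and> \<S> \<subseteq> N}"
  define \<alpha> where "\<alpha> = (SUP \<S>\<in>W. prob (\<Union>\<S>))"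
  have bdd: "bdd_above ((\<lambda>\<S>. prob (\<Union>\<S>)) ` W)" by (auto intro!: bdd_aboveI[of _ 1])
  have W0: "{} \<in> W" by (auto simp: W_def)
  have WS: "\<Union>\<S> \<in> sets M" if "\<S> \<in> W" for \<S>
    using that by (auto simp: W_def N_def intro!: sets.countable_Union)
  have "\<exists>\<S>\<in>W. \<alpha> - 1 / Suc n < prob (\<Union>\<S>)" for n
    using less_cSUP_iff[OF _ bdd, of "\<alpha> - 1 / Suc n"] W0 by (auto simp: \<alpha>_def)
  then obtain T where T: "\<And>n. T n \<in> W" "\<And>n. \<alpha> - 1 / Suc n < prob (\<Union>(T n))" by metis
  define S where "S = (\<Union>n. T n)"
  have SW: "S \<in> W" using T(1) by (auto simp: S_def W_def)
  have S_ge: "\<alpha> \<le> prob (\<Union>S)"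
  proof (rule LIMSEQ_le_const2)
    show "(\<lambda>n. \<alpha> - 1 / Suc n) \<longlonglongrightarrow> \<alpha>"
      using tendsto_diff[OF tendsto_const lim_1_over_n[THEN LIMSEQ_Suc]] by simp
    show "\<exists>N. \<forall>n\<ge>N. \<alpha> - 1 / Suc n \<le> prob (\<Union>S)"
    proof (intro exI allI impI)
      fix n
      have "prob (\<Union>(T n)) \<le> prob (\<Union>S)"
        by (rule finite_measure_mono) (use WS[OF SW] in \<open>auto simp: S_def\<close>)
      then show "\<alpha> - 1 / Suc n \<le> prob (\<Union>S)" using T(2)[of n] by linarith
    qed
  qed
  \<comment> \<open>The empty set is never split; adding it makes the family nonempty, so that
    \<open>from_nat_into\<close> enumerates it.\<close>
  define V where "V = insert {} S"
  have V: "V \<noteq> {}" "countable V" "V \<subseteq> N" "\<Union>V = \<Union>S"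
    using SW by (auto simp: V_def W_def N_def splits_def)
  define H where "H n = (\<Union>i<n. from_nat_into V i)" for n :: nat
  have in_N: "from_nat_into V i \<in> N" for i using V(3) from_nat_into[OF V(1)] by blast
  have Hs: "H n \<in> sets M" for n
    unfolding H_def using in_N by (intro sets.finite_UN) (auto simp: N_def)
  have prob_H: "prob (H n) \<le> 1 - \<eta>" for n
  proof -
    define P where "P = insert (space M - H n) (from_nat_into V ` {..<n})"
    have PF: "P \<in> finite_covers M"
      using Hs[of n] in_N sets.sets_into_space
      by (auto simp: P_def finite_covers_def H_def N_def)
    have "eventually (\<lambda>C. \<forall>A\<in>from_nat_into V ` {..<n}. \<not> splits M C A) U"
      using in_N by (intro eventually_ball_finite) (auto simp: N_def)
    with bd[OF PF] have "eventually (\<lambda>C. \<eta> \<le> prob (space M - H n)) U"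
    proof eventually_elim
      case (elim C)
      have "boundary M P C \<subseteq> space M - H n" using elim(2) by (auto simp: boundary_def P_def)
      then have "prob (boundary M P C) \<le> prob (space M - H n)"
        by (rule finite_measure_mono) (use Hs in auto)
      with elim(1) show ?case by simp
    qed
    \<comment> \<open>The inequality no longer depends on \<open>C\<close>, so holding eventually
      along a proper filter means holding outright.\<close>
    with U(1) have "\<eta> \<le> prob (space M - H n)" by (simp add: eventually_const)
    then show ?thesis using prob_compl[OF Hs[of n]] by simp
  qed
  have H_Un: "(\<Union>n. H n) = \<Union>S"
  proof -
    have "(\<Union>n. H n) = (\<Union>i. from_nat_into V i)" by (auto simp: H_def)
    then show ?thesis using range_from_nat_into[OF V(1,2)] V(4) by simp
  qed
  have "(\<lambda>n. prob (H n)) \<longlonglongrightarrow> prob (\<Union>n. H n)"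
    using Hs by (intro finite_Lim_measure_incseq) (force simp: H_def incseq_def)+
  then have "prob (\<Union>S) \<le> 1 - \<eta>"
    using prob_H H_Un by (intro LIMSEQ_le_const2) auto
  then have pos: "0 < prob (space M - \<Union>S)"
    using prob_compl[OF WS[OF SW]] \<open>0 < \<eta>\<close> by simp
  show ?thesis
  proof (rule that[of "space M - \<Union>S"])
    fix B assume B: "B \<in> sets M" "B \<subseteq> space M - \<Union>S" "0 < prob B"
    show "eventually (\<lambda>C. splits M C B) U"
    proof (rule ccontr)
      assume "\<not> ?thesis"
      \<comment> \<open>By the ultrafilter property \<open>B\<close> is unsplit by
        \<open>U\<close>-most \<open>C\<close>. Being non-null and disjoint from
        \<open>\<Union>S\<close>, it would push the probability beyond the supremum
        \<open>\<alpha>\<close>.\<close>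
      then have "B \<in> N" using U(2) B by (auto simp: N_def)
      then have BW: "insert B S \<in> W" using SW by (auto simp: W_def)
      have "prob (\<Union>(insert B S)) = prob B + prob (\<Union>S)"
        using finite_measure_Union[OF B(1) WS[OF SW]] B(2) by (simp add: Int_commute) blast
      moreover have "prob (\<Union>(insert B S)) \<le> \<alpha>"
        unfolding \<alpha>_def by (rule cSUP_upper[OF BW bdd])
      ultimately show False using S_ge B(3) by simp
    qed
  qed (use pos WS[OF SW] in auto)
qed

text \<open>By induction, the \<open>2 ^ n\<close> atoms in \<open>G\<close> of the sets chosen so
  far are non-null. Each is split by \<open>U\<close>-most \<open>C\<close>, hence so are all of
  them simultaneously, and any such \<open>C\<close> in \<open>\<C>\<close> serves as the next
  set.\<close>

lemma (in prob_space) independent_sets_of_splitting: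
  fixes U :: "'a set filter"
  assumes U: "U \<noteq> bot" "eventually (\<lambda>C. C \<in> \<C>) U" "\<C> \<subseteq> sets M"
    and G: "G \<in> sets M" "0 < prob G"
      "\<And>B. B \<in> sets M \<Longrightarrow> B \<subseteq> G \<Longrightarrow> 0 < prob B \<Longrightarrow> eventually (\<lambda>C. splits M C B) U"
  shows "\<exists>c::nat \<Rightarrow> 'a set. (\<forall>j<n. c j \<in> \<C>) \<and>
    (\<forall>J\<subseteq>{..<n}. 0 < prob {x\<in>G. \<forall>j<n. x \<in> c j \<longleftrightarrow> j \<in> J})"
proof (induction n)
  case 0
  then show ?case using G by simp
next
  case (Suc n)
  then obtain c where c: "\<And>j. j < n \<Longrightarrow> c j \<in> \<C>"
    and pos: "\<And>J. J \<subseteq> {..<n} \<Longrightarrow> 0 < prob {x\<in>G. \<forall>j<n. x \<in> c j \<longleftrightarrow> j \<in> J}" by auto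
  define A where "A J = {x\<in>G. \<forall>j<n. x \<in> c j \<longleftrightarrow> j \<in> J}" for J
  have A_sets: "A J \<in> sets M" for J
  proof -
    have "A J = G \<inter> {x\<in>space M. \<forall>j\<in>{..<n}. x \<in> c j \<longleftrightarrow> j \<in> J}"
      using sets.sets_into_space[OF G(1)] by (auto simp: A_def)
    moreover have "{x\<in>space M. \<forall>j\<in>{..<n}. x \<in> c j \<longleftrightarrow> j \<in> J} \<in> sets M"
    proof (rule sets.sets_Collect_finite_All)
      fix j assume "j \<in> {..<n}"
      then have cj[measurable]: "c j \<in> sets M" using c U(3) by auto
      show "{x\<in>space M. x \<in> c j \<longleftrightarrow> j \<in> J} \<in> sets M" by measurable
    qed auto
    ultimately show ?thesis using G(1) by auto
  qed
  have "eventually (\<lambda>C. splits M C (A J)) U" if "J \<subseteq> {..<n}" for J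
    using A_sets by (rule G(3)) (use pos[OF that] in \<open>auto simp: A_def\<close>)
  then have "eventually (\<lambda>C. \<forall>J\<in>Pow {..<n}. splits M C (A J)) U"
    by (intro eventually_ball_finite) auto
  with U(2) have "eventually (\<lambda>C. C \<in> \<C> \<and> (\<forall>J\<in>Pow {..<n}. splits M C (A J))) U"
    by (rule eventually_conj)
  then obtain C where C: "C \<in> \<C>" "\<And>J. J \<subseteq> {..<n} \<Longrightarrow> splits M C (A J)"
    using eventually_happens'[OF U(1)] by blast
  show ?case
  proof (intro exI[of _ "c(n := C)"] conjI allI impI)
    fix J assume J: "J \<subseteq> {..<Suc n}"
    \<comment> \<open>\<open>J - {n}\<close> selects the old atom, and whether
      \<open>n \<in> J\<close> selects the half of it that lies inside or outside
      \<open>C\<close>.\<close>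
    have J': "J - {n} \<subseteq> {..<n}" using J by (auto simp: less_Suc_eq)
    define A' where "A' = A (J - {n})"
    have "{x\<in>G. \<forall>j<Suc n. x \<in> (c(n := C)) j \<longleftrightarrow> j \<in> J} =
      (if n \<in> J then A' \<inter> C else A' - C)"
      by (auto simp: A'_def A_def less_Suc_eq)
    then show "0 < prob {x\<in>G. \<forall>j<Suc n. x \<in> (c(n := C)) j \<longleftrightarrow> j \<in> J}"
      using C(2)[OF J'] by (simp add: splits_def flip: A'_def)
  next
    fix j assume "j < Suc n"
    then show "(c(n := C)) j \<in> \<C>" using c C(1) by (cases "j = n") auto
  qed
qed

lemma (in prob_space) small_boundary_cover:
  assumes CM: "\<C> \<subseteq> sets M" and "\<not> shatters_some \<C> k" and "0 < \<eta>"
  shows "\<exists>P\<in>finite_covers M. \<forall>C\<in>\<C>. prob (boundary M P C) < \<eta>"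
proof (rule ccontr)
  assume "\<not> ?thesis"
  then have ne: "\<And>P. P \<in> finite_covers M \<Longrightarrow> \<exists>C\<in>\<C>. \<eta> \<le> prob (boundary M P C)"
    by (auto simp: not_less)
  define K where "K P = {C\<in>\<C>. \<eta> \<le> prob (boundary M P C)}" for P
  define F where "F = (\<Sqinter>P\<in>finite_covers M. principal (K P))"
  have sp: "{space M} \<in> finite_covers M" by (auto simp: finite_covers_def)
  have ev: "eventually Q F \<longleftrightarrow> (\<exists>P\<in>finite_covers M. eventually Q (principal (K P)))" for Q
    unfolding F_def
  proof (rule eventually_INF_base)
    fix P Q assume PQ: "P \<in> finite_covers M" "Q \<in> finite_covers M"
    \<comment> \<open>A split cell of the common refinement lies in split cells of both covers.
      Refining therefore shrinks boundaries, which makes the families \<open>K P\<close> a filter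
      base.\<close>
    define R where "R = (\<lambda>(A, B). A \<inter> B) ` (P \<times> Q)"
    have "\<Union>R = \<Union>P \<inter> \<Union>Q" by (auto simp: R_def)
    then have R: "R \<in> finite_covers M"
      using PQ by (auto simp: finite_covers_def R_def)
    have sub: "boundary M R C \<subseteq> boundary M P C \<inter> boundary M Q C" if "C \<in> \<C>" for C
    proof
      fix x assume "x \<in> boundary M R C"
      then obtain A B where AB: "A \<in> P" "B \<in> Q" "x \<in> A \<inter> B" "splits M C (A \<inter> B)"
        by (auto simp: boundary_def R_def)
      have "splits M C A" "splits M C B"
        using AB PQ CM \<open>C \<in> \<C>\<close> by (auto simp: finite_covers_def intro!: splits_mono[OF AB(4)])
      with AB show "x \<in> boundary M P C \<inter> boundary M Q C" by (auto simp: boundary_def)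
    qed
    have "K R \<subseteq> K P \<inter> K Q"
    proof
      fix C assume C: "C \<in> K R"
      then have "prob (boundary M R C) \<le> prob (boundary M P C)"
        "prob (boundary M R C) \<le> prob (boundary M Q C)"
        using sub[of C] boundary_sets[OF PQ(1)] boundary_sets[OF PQ(2)]
        by (auto simp: K_def intro!: finite_measure_mono)
      with C show "C \<in> K P \<inter> K Q" by (auto simp: K_def)
    qed
    with R show "\<exists>x\<in>finite_covers M. principal (K x) \<le> inf (principal (K P)) (principal (K Q))"
      by auto
  qed (use sp in auto)
  have "F \<noteq> bot"
    using ne by (auto simp: trivial_limit_def ev eventually_principal K_def)
  then obtain U where U: "U \<le> F" "U \<noteq> bot"
    "\<And>P. eventually P U \<or> eventually (\<lambda>x. \<not> P x) U"
    using ultrafilter_exists by blast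
  have K_ev: "eventually (\<lambda>C. C \<in> K P) U" if "P \<in> finite_covers M" for P
    using that U(1) by (intro filter_leD[OF U(1)]) (auto simp: ev eventually_principal)
  have bd: "eventually (\<lambda>C. \<eta> \<le> prob (boundary M P C)) U" if "P \<in> finite_covers M" for P
    using K_ev[OF that] by eventually_elim (simp add: K_def)
  have evC: "eventually (\<lambda>C. C \<in> \<C>) U" using K_ev[OF sp] by eventually_elim (simp add: K_def)
  obtain G where "G \<in> sets M" "0 < prob G"
    "\<And>B. B \<in> sets M \<Longrightarrow> B \<subseteq> G \<Longrightarrow> 0 < prob B \<Longrightarrow> eventually (\<lambda>C. splits M C B) U"
    using uniformly_split_set[OF U(2,3) bd \<open>0 < \<eta>\<close>] by blast
  \<comment> \<open>Dual shattering of \<open>k\<close> points takes \<open>2 ^ k\<close>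
    independent sets.\<close>
  then obtain c where c: "\<And>j::nat. j < 2 ^ k \<Longrightarrow> c j \<in> \<C>"
    and pos: "\<And>J. J \<subseteq> {..<2 ^ k} \<Longrightarrow> 0 < prob {x\<in>G. \<forall>j<2 ^ k. x \<in> c j \<longleftrightarrow> j \<in> J}"
    using independent_sets_of_splitting[OF U(2) evC CM, of G "2 ^ k"] by blast
  have "shatters_some \<C> k"
  proof (rule shatters_some_if_independent)
    fix J :: "nat set" assume "J \<subseteq> {..<2 ^ k}"
    then have "{x\<in>G. \<forall>j<2 ^ k. x \<in> c j \<longleftrightarrow> j \<in> J} \<noteq> {}" using pos[of J] by force
    then show "\<exists>x. \<forall>j<2 ^ k. x \<in> c j \<longleftrightarrow> j \<in> J" by blast
  qed (use c in auto)
  with assms(2) show False by contradiction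
qed

section \<open>The uniform law for a class of sets\<close>

text \<open>Each \<open>C\<close> is bracketed almost everywhere by two unions of cells of one
  finite cover. Half of \<open>\<epsilon>\<close> pays for the gap between the brackets, half for
  the convergence of the averages over these finitely many unions.\<close>

lemma uniform_lln_sets:
  fixes X :: "nat \<Rightarrow> 'w \<Rightarrow> 'a"
  assumes N: "prob_space N"
    and X[measurable]: "\<And>i. X i \<in> measurable M N" and law: "\<And>i. distr M N (X i) = N"
    and lln: "\<And>A. A \<in> sets N \<Longrightarrow>
      AE \<omega> in M. (\<lambda>n. (\<Sum>i<n. indicator A (X i \<omega>)) / real n) \<longlonglongrightarrow> measure N A"
    and "countable \<C>" and sets_C: "\<C> \<subseteq> sets N" and "\<not> shatters_some \<C> k" and "0 < \<epsilon>"
  shows "AE \<omega> in M. \<forall>\<^sub>F n in sequentially. \<forall>C\<in>\<C>.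
    \<bar>(\<Sum>i<n. indicator C (X i \<omega>)) / real n - measure N C\<bar> < \<epsilon>"
proof -
  interpret N: prob_space N by (rule N)
  obtain P where P: "P \<in> finite_covers N"
    and bd: "\<And>C. C \<in> \<C> \<Longrightarrow> N.prob (boundary N P C) < \<epsilon> / 2"
    using N.small_boundary_cover[OF sets_C \<open>\<not> shatters_some \<C> k\<close>, of "\<epsilon> / 2"] \<open>0 < \<epsilon>\<close> by auto
  have finP: "finite P" and setsP: "\<And>A. A \<in> P \<Longrightarrow> A \<in> sets N" and UnP: "\<Union>P = space N"
    using P by (auto simp: finite_covers_def)
  \<comment> \<open>\<open>lo C\<close> collects the cells essentially contained in
    \<open>C\<close>, \<open>hi C\<close> those meeting \<open>C\<close> in a non-null set; a cell
    in the second family but not in the first is split by \<open>C\<close>.\<close>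
  define lo where "lo C = \<Union>{A\<in>P. N.prob (A - C) = 0}" for C
  define hi where "hi C = \<Union>{A\<in>P. N.prob (A \<inter> C) \<noteq> 0}" for C
  have union_sets: "\<Union>\<A> \<in> sets N" if "\<A> \<subseteq> P" for \<A>
    using that setsP finite_subset[OF that finP] by (intro sets.finite_Union) auto
  have lo_sets: "lo C \<in> sets N" and hi_sets: "hi C \<in> sets N" for C
    by (auto simp: lo_def hi_def intro!: union_sets)
  have sandwich: "AE x in N. (x \<in> lo C \<longrightarrow> x \<in> C) \<and> (x \<in> C \<longrightarrow> x \<in> hi C)" if "C \<in> \<C>" for C
  proof -
    have null: "AE x in N. N.prob A = 0 \<longrightarrow> x \<notin> A" if "A \<in> sets N" for A
      using that by (cases "N.prob A = 0") (auto simp: N.prob_eq_0)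
    have "C \<in> sets N" using that sets_C by auto
    then have "AE x in N. \<forall>A\<in>P. (N.prob (A - C) = 0 \<longrightarrow> x \<notin> A - C) \<and>
        (N.prob (A \<inter> C) = 0 \<longrightarrow> x \<notin> A \<inter> C)"
      using finP setsP by (intro AE_finite_allI AE_conjI null) auto
    then show ?thesis
      using AE_space
    proof eventually_elim
      case (elim x)
      then obtain A where "A \<in> P" "x \<in> A" using UnP by blast
      with elim(1) show ?case by (fastforce simp: lo_def hi_def)
    qed
  qed
  have prob_le: "N.prob (lo C) \<le> N.prob C" "N.prob C \<le> N.prob (hi C)"
    "N.prob (hi C) < N.prob (lo C) + \<epsilon> / 2" if "C \<in> \<C>" for C
  proof -
    have C: "C \<in> sets N" using that sets_C by auto
    show "N.prob (lo C) \<le> N.prob C" "N.prob C \<le> N.prob (hi C)"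
      using sandwich[OF that] C hi_sets by (auto intro!: N.finite_measure_mono_AE)
    have "hi C \<subseteq> lo C \<union> boundary N P C"
      by (auto simp: hi_def lo_def boundary_def splits_def zero_less_measure_iff)
    then have "N.prob (hi C) \<le> N.prob (lo C \<union> boundary N P C)"
      using lo_sets boundary_sets[OF P] by (intro N.finite_measure_mono) auto
    also have "\<dots> \<le> N.prob (lo C) + N.prob (boundary N P C)"
      using lo_sets boundary_sets[OF P] by (intro measure_Un_le) auto
    finally show "N.prob (hi C) < N.prob (lo C) + \<epsilon> / 2" using bd[OF that] by simp
  qed
  \<comment> \<open>Countability of \<open>\<C>\<close> gives a single null set for all
    \<open>C\<close> and all times \<open>i\<close>; the bracketing holds at time \<open>i\<close>
    because \<open>X i\<close> has law \<open>N\<close>.\<close>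
  have "AE \<omega> in M. \<forall>C\<in>\<C>. \<forall>i. (X i \<omega> \<in> lo C \<longrightarrow> X i \<omega> \<in> C) \<and> (X i \<omega> \<in> C \<longrightarrow> X i \<omega> \<in> hi C)"
  proof -
    have "AE \<omega> in M. (X i \<omega> \<in> lo C \<longrightarrow> X i \<omega> \<in> C) \<and> (X i \<omega> \<in> C \<longrightarrow> X i \<omega> \<in> hi C)"
      if "C \<in> \<C>" for C i
    proof (rule AE_distrD[OF X[of i]])
      show "AE x in distr M N (X i). (x \<in> lo C \<longrightarrow> x \<in> C) \<and> (x \<in> C \<longrightarrow> x \<in> hi C)"
        unfolding law by (rule sandwich[OF that])
    qed
    then show ?thesis using \<open>countable \<C>\<close> by (simp add: AE_ball_countable AE_all_countable)
  qed
  moreover have "AE \<omega> in M. \<forall>\<A>\<in>Pow P.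
      (\<lambda>n. (\<Sum>i<n. indicator (\<Union>\<A>) (X i \<omega>)) / real n) \<longlonglongrightarrow> N.prob (\<Union>\<A>)"
    using finP union_sets by (intro AE_finite_allI lln) auto
  ultimately show ?thesis
  proof eventually_elim
    case (elim \<omega>)
    let ?avg = "\<lambda>n A. (\<Sum>i<n. indicator A (X i \<omega>)) / real n"
    have "\<forall>\<^sub>F n in sequentially. \<forall>\<A>\<in>Pow P. dist (?avg n (\<Union>\<A>)) (N.prob (\<Union>\<A>)) < \<epsilon> / 2"
      using finP elim(2) \<open>0 < \<epsilon>\<close> by (intro eventually_ball_finite ballI tendstoD) auto
    then show ?case
    proof eventually_elim
      case conv: (elim n)
      show ?case
      proof
        fix C assume C: "C \<in> \<C>"
        have "indicator (lo C) (X i \<omega>) \<le> (indicator C (X i \<omega>) :: real)"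
          "indicator C (X i \<omega>) \<le> (indicator (hi C) (X i \<omega>) :: real)" for i
          using elim(1) C by (auto simp: indicator_def)
        then have "?avg n (lo C) \<le> ?avg n C" "?avg n C \<le> ?avg n (hi C)"
          by (intro divide_right_mono sum_mono; simp)+
        moreover have "dist (?avg n (lo C)) (N.prob (lo C)) < \<epsilon> / 2"
          "dist (?avg n (hi C)) (N.prob (hi C)) < \<epsilon> / 2"
          unfolding lo_def hi_def by (rule conv[rule_format]; blast)+
        ultimately show "\<bar>?avg n C - N.prob C\<bar> < \<epsilon>"
          using prob_le[OF C] unfolding dist_real_def by linarith
      qed
    qed
  qed
qed

section \<open>Sections of graphs and discretization\<close>

text \<open>A set \<open>D\<close> shattered by the sections lifts to the slice of points
  \<open>(x, s)\<close> with \<open>x \<in> D\<close>, which the graphs shatter. One bound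
  \<open>k\<close> thus serves all levels \<open>s\<close>.\<close>

lemma shatters_some_graph_section:
  assumes "shatters_some ((\<lambda>f. {x. (x, s) \<in> fun_graph f}) ` F) k"
  shows "shatters_some (fun_graph ` F) k"
proof -
  let ?sec = "\<lambda>f. {x. (x, s) \<in> fun_graph f}"
  obtain D where D: "finite D" "card D = k" "trace_count D (?sec ` F) = 2 ^ k"
    using assms by (auto simp: shatters_some_def)
  let ?D = "(\<lambda>x. (x, s)) ` D"
  have card: "card ?D = k" using D(2) by (simp add: card_image inj_on_def)
  have "trace_count ?D (fun_graph ` F) = 2 ^ card ?D"
  proof (rule trace_count_eqI)
    fix E assume "E \<subseteq> ?D"
    then obtain E' where E': "E' \<subseteq> D" "E = (\<lambda>x. (x, s)) ` E'" by (meson subset_imageE)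
    then obtain f where "f \<in> F" "?sec f \<inter> D = E'"
      using trace_count_eqD[of D "?sec ` F" E'] D by auto
    then show "\<exists>G\<in>fun_graph ` F. G \<inter> ?D = E"
      using E'(2) by (intro bexI[of _ "fun_graph f"]) auto
  qed (use D(1) in simp)
  with card show ?thesis
    unfolding shatters_some_def using D(1) by (intro exI[of _ ?D]) simp
qed

lemma vc_graph_class_not_shatters:
  assumes "vc_graph_class F"
  obtains k where "\<not> shatters_some (fun_graph ` F) k"
proof -
  have "\<not> (\<forall>k\<ge>1. shatters_some (fun_graph ` F) k)"
  proof
    assume "\<forall>k\<ge>1. shatters_some (fun_graph ` F) k"
    then have "vc_dim (fun_graph ` F) = \<infinity>" unfolding vc_dim_def by (rule if_P)
    then show False using assms by (simp add: vc_graph_class_def)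
  qed
  then show ?thesis using that by blast
qed

text \<open>The sum is \<open>y\<close> rounded down to a multiple of \<open>d\<close>; the bound
  \<open>y \<le> real J * d\<close> ensures that no level below \<open>y\<close> is missing.\<close>

lemma grid_count:
  fixes y d :: real
  assumes "0 < d" "0 \<le> y" "y \<le> real J * d"
  shows "\<bar>y - (\<Sum>j=1..J. d * of_bool (real j * d \<le> y))\<bar> \<le> d"
proof -
  define q where "q = nat \<lfloor>y / d\<rfloor>"
  have "0 \<le> y / d" using assms by simp
  then have "real q \<le> y / d" "y / d \<le> real q + 1" unfolding q_def by linarith+
  then have q: "real q * d \<le> y" "y \<le> real q * d + d"
    using \<open>0 < d\<close> by (simp_all add: pos_le_divide_eq pos_divide_le_eq distrib_right)
  have iff: "real j * d \<le> y \<longleftrightarrow> j \<le> q" for j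
  proof
    assume "real j * d \<le> y"
    then have "real j \<le> y / d" using \<open>0 < d\<close> by (simp add: pos_le_divide_eq)
    then show "j \<le> q" unfolding q_def by (rule le_nat_floor)
  next
    assume "j \<le> q"
    then have "real j * d \<le> real q * d" using \<open>0 < d\<close> by simp
    then show "real j * d \<le> y" using q(1) by linarith
  qed
  have "q \<le> J"
  proof -
    have "real q * d \<le> real J * d" using q(1) assms(3) by linarith
    then show ?thesis using \<open>0 < d\<close> by simp
  qed
  then have "{1..J} \<inter> {j. real j * d \<le> y} = {1..q}" unfolding iff by auto
  moreover have "(\<Sum>j=1..J. d * of_bool (real j * d \<le> y)) =
      d * real (card ({1..J} \<inter> {j. real j * d \<le> y}))"
    by (simp only: sum_of_bool_eq finite_atLeastAtMost flip: sum_distrib_left)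
  ultimately have "(\<Sum>j=1..J. d * of_bool (real j * d \<le> y)) = real q * d"
    by simp
  then show ?thesis using q \<open>0 < d\<close> by (simp only: abs_le_iff) linarith
qed

text \<open>Only one of the two families of indicators can be nonzero, according to the sign of
  \<open>y\<close>. Starting at \<open>j = 1\<close> matters, since at level \<open>0\<close> both
  conditions could hold.\<close>

lemma grid_approx:
  fixes y d :: real
  assumes "0 < d" "\<bar>y\<bar> \<le> real J * d"
  shows "\<bar>y - (\<Sum>j=1..J. d * (of_bool (real j * d \<le> y) - of_bool (y \<le> - (real j * d))))\<bar> \<le> d"
proof (cases "0 \<le> y")
  case True
  have "\<not> y \<le> - (real j * d)" if "j \<in> {1..J}" for j
  proof -
    have "0 < real j * d" using that \<open>0 < d\<close> by simp
    then show ?thesis using True by linarith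
  qed
  then have "(\<Sum>j=1..J. d * (of_bool (real j * d \<le> y) - of_bool (y \<le> - (real j * d)))) =
      (\<Sum>j=1..J. d * of_bool (real j * d \<le> y))"
    by (intro sum.cong) auto
  then show ?thesis using grid_count[of d y J] assms True by simp
next
  case False
  have "\<not> real j * d \<le> y" if "j \<in> {1..J}" for j
  proof -
    have "0 < real j * d" using that \<open>0 < d\<close> by simp
    then show ?thesis using False by linarith
  qed
  then have "(\<Sum>j=1..J. d * (of_bool (real j * d \<le> y) - of_bool (y \<le> - (real j * d)))) =
      (\<Sum>j=1..J. - (d * of_bool (real j * d \<le> - y)))"
    by (intro sum.cong) auto
  then show ?thesis using grid_count[of d "- y" J] assms False by (simp add: sum_negf abs_le_iff)
qed

section \<open>Stationary ergodic processes\<close>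

lemma path_measurable:
  assumes "\<And>i. X i \<in> borel_measurable M"
  shows "(\<lambda>\<omega> i. X i \<omega>) \<in> measurable M path_space"
  unfolding path_space_def by (rule measurable_PiM_single') (use assms in auto)

lemma path_shift_measurable: "path_shift \<in> measurable path_space path_space"
  unfolding path_space_def path_shift_def[abs_def] by (rule measurable_PiM_single') auto

lemma path_shift_funpow: "(path_shift ^^ n) x i = x (n + i)"
  by (induction n arbitrary: i) (auto simp: path_shift_def)

lemma process_law_shift:
  assumes "stationary_process M X"
  shows "distr (process_law M X) (process_law M X) path_shift = process_law M X"
proof -
  have X: "\<And>i. X i \<in> borel_measurable M" using assms by (simp add: stationary_process_def)
  have "distr (process_law M X) (process_law M X) path_shift =
      distr (process_law M X) path_space path_shift"
    by (rule distr_cong) (auto simp: process_law_def)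
  also have "\<dots> = process_law M (\<lambda>i. X (Suc i))"
    unfolding process_law_def
    by (subst distr_distr[OF path_shift_measurable path_measurable[OF X]])
      (simp add: comp_def path_shift_def)
  finally show ?thesis using assms by (simp add: stationary_process_def)
qed

text \<open>Coordinate \<open>i\<close> of the shifted process is \<open>X (Suc i)\<close>, while
  equality of the path laws gives it the distribution of \<open>X i\<close>.\<close>

lemma stationary_marginal:
  assumes "stationary_process M X"
  shows "distr M borel (X i) = distr M borel (X 0)"
proof (induction i)
  case (Suc i)
  have X: "\<And>i. X i \<in> borel_measurable M" using assms by (simp add: stationary_process_def)
  have coord: "(\<lambda>p. p i) \<in> borel_measurable path_space" for i :: nat
    unfolding path_space_def by simp
  have "distr M borel (Y i) = distr (process_law M Y) borel (\<lambda>p. p i)"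
    if "\<And>i. Y i \<in> borel_measurable M" for Y
    unfolding process_law_def
    by (subst distr_distr[OF coord path_measurable[OF that]]) (simp add: comp_def)
  from this[of X, OF X] this[of "\<lambda>i. X (Suc i)", OF X]
  show ?case using Suc assms by (simp add: stationary_process_def)
qed simp

text \<open>The ergodic theorem is applied to the shift on path space and the indicator of
  \<open>A\<close> at coordinate \<open>0\<close>, then pulled back to \<open>M\<close> along the
  path map.\<close>

lemma stationary_ergodic_lln:
  assumes "prob_space M" "stationary_process M X" "ergodic_process M X" "A \<in> sets borel"
  shows "AE \<omega> in M. (\<lambda>n. (\<Sum>i<n. indicator A (X i \<omega>)) / real n)
    \<longlonglongrightarrow> measure (distr M borel (X 0)) A"
proof -
  have X: "\<And>i. X i \<in> borel_measurable M" using assms(2) by (simp add: stationary_process_def)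
  note pX = path_measurable[OF X]
  let ?Q = "process_law M X"
  interpret Q: prob_space ?Q
    unfolding process_law_def by (rule prob_space.prob_space_distr[OF assms(1) pX])
  have sets_Q[measurable_cong]: "sets ?Q = sets path_space" by (simp add: process_law_def)
  have space_Q: "space ?Q = UNIV" by (simp add: process_law_def path_space_def space_PiM)
  have coord: "(\<lambda>p. p i) \<in> borel_measurable path_space" for i :: nat
    unfolding path_space_def by simp
  have ind: "(\<lambda>p. indicator A (p 0) :: real) \<in> borel_measurable path_space"
    using coord[of 0] assms(4) by measurable
  have "AE p in ?Q. (\<lambda>n. (\<Sum>i<n. indicator A ((path_shift ^^ i) p 0)) / real n)
      \<longlonglongrightarrow> Q.expectation (\<lambda>p. indicator A (p 0))"
  proof (rule Q.birkhoff_ergodic_bounded[where B = 1])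
    show "path_shift \<in> measurable ?Q ?Q" using path_shift_measurable by measurable
    show "distr ?Q ?Q path_shift = ?Q" by (rule process_law_shift[OF assms(2)])
    fix B assume "B \<in> sets ?Q" "path_shift -` B \<inter> space ?Q = B"
    then have "B \<in> invariant_sets" by (simp add: invariant_sets_def sets_Q space_Q)
    then show "Q.prob B = 0 \<or> Q.prob B = 1" using assms(3) by (simp add: ergodic_process_def)
  qed (use ind in \<open>auto simp: indicator_def\<close>)
  then have "AE \<omega> in M. (\<lambda>n. (\<Sum>i<n. indicator A (X i \<omega>)) / real n)
      \<longlonglongrightarrow> Q.expectation (\<lambda>p. indicator A (p 0))"
    unfolding process_law_def path_shift_funpow by (auto dest: AE_distrD[OF pX])
  moreover have "Q.expectation (\<lambda>p. indicator A (p 0)) = measure (distr M borel (X 0)) A"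
  proof -
    have "Q.expectation (\<lambda>p. indicator A (p 0) :: real) = (\<integral>\<omega>. indicator A (X 0 \<omega>) \<partial>M)"
      unfolding process_law_def by (rule integral_distr[OF pX ind])
    also have "\<dots> = (\<integral>x. indicator A x \<partial>distr M borel (X 0))"
      using assms(4) by (intro integral_distr[symmetric] X) auto
    finally show ?thesis using assms(4) by simp
  qed
  ultimately show ?thesis by simp
qed

section \<open>The uniform ergodic theorem\<close>

text \<open>Taking the supremum in \<open>ennreal\<close> makes it meaningful without a separate
  boundedness argument, with value \<open>0\<close> for empty \<open>F\<close>.\<close>

theorem proposition2:
  fixes F :: "('a::polish_space \<Rightarrow> real) set"
    and M :: "'w measure"
    and X :: "nat \<Rightarrow> 'w \<Rightarrow> 'a"
  assumes "countable F"
    and "\<And>f. f \<in> F \<Longrightarrow> f \<in> borel_measurable borel"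
    and "bounded_family F"
    and "vc_graph_class F"
    and "prob_space M"
    and "stationary_process M X"
    and "ergodic_process M X"
  shows "AE \<omega> in M.
    (\<lambda>m. SUP f\<in>F. ennreal \<bar>(\<Sum>i<m. f (X i \<omega>)) / real m - (\<integral>x. f x \<partial>distr M borel (X 0))\<bar>)
      \<longlonglongrightarrow> 0"
proof -
  interpret prob_space M by (rule assms(5))
  have X[measurable]: "\<And>i. X i \<in> borel_measurable M"
    using assms(6) by (simp add: stationary_process_def)
  let ?N = "distr M borel (X 0)"
  interpret N: prob_space ?N by (rule prob_space_distr[OF X])
  obtain B where B: "\<And>f x. f \<in> F \<Longrightarrow> \<bar>f x\<bar> \<le> B"
    using assms(3) by (auto simp: bounded_family_def)
  obtain k where k: "\<not> shatters_some (fun_graph ` F) k"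
    using vc_graph_class_not_shatters[OF assms(4)] .
  define S where "S s f = {x. (x, s) \<in> fun_graph f}" for s and f :: "'a \<Rightarrow> real"
  have S: "S s f \<in> sets borel" if "f \<in> F" for s f
  proof -
    note [measurable] = assms(2)[OF that]
    have "{x \<in> space borel. 0 \<le> s \<and> s \<le> f x \<or> f x \<le> s \<and> s \<le> 0} \<in> sets borel" by measurable
    then show ?thesis by (simp add: S_def fun_graph_def)
  qed
  let ?avg = "\<lambda>\<omega> n (f :: 'a \<Rightarrow> real). (\<Sum>i<n. f (X i \<omega>)) / real n"
  let ?E = "\<lambda>f. integral\<^sup>L ?N f :: real"
  have sections: "AE \<omega> in M. \<forall>\<^sub>F n in sequentially. \<forall>f\<in>F.
      \<bar>?avg \<omega> n (indicator (S s f)) - ?E (indicator (S s f))\<bar> < \<epsilon>" if "0 < \<epsilon>" for s \<epsilon>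
  proof -
    have "AE \<omega> in M. \<forall>\<^sub>F n in sequentially. \<forall>C\<in>S s ` F.
      \<bar>?avg \<omega> n (indicator C) - measure ?N C\<bar> < \<epsilon>"
    proof (rule uniform_lln_sets)
      show "\<not> shatters_some (S s ` F) k"
        using k shatters_some_graph_section[of s F k] by (auto simp: S_def)
      show "distr M ?N (X i) = ?N" for i
        using stationary_marginal[OF assms(6), of i] by (simp cong: distr_cong)
      show "AE \<omega> in M. (\<lambda>n. ?avg \<omega> n (indicator A)) \<longlonglongrightarrow> measure ?N A" if "A \<in> sets ?N" for A
        using stationary_ergodic_lln[OF assms(5-7), of A] that by simp
    qed (use S assms(1) that N.prob_space_axioms in auto)
    then show ?thesis using S by simp
  qed
  have uniform: "AE \<omega> in M. \<forall>\<^sub>F n in sequentially. \<forall>f\<in>F. \<bar>?avg \<omega> n f - ?E f\<bar> \<le> \<epsilon>"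
    if "0 < \<epsilon>" for \<epsilon>
  proof -
    \<comment> \<open>Replacing \<open>f\<close> by its discretization costs \<open>d\<close> in the
      average and \<open>d\<close> in the mean; the remaining \<open>\<epsilon> / 2\<close> is for
      the sections.\<close>
    define d where "d = \<epsilon> / 4"
    have d: "0 < d" using that by (simp add: d_def)
    define J where "J = nat \<lceil>B / d\<rceil>"
    have J: "B \<le> real J * d"
    proof -
      have "B / d \<le> real J" unfolding J_def by linarith
      then show ?thesis using d by (simp add: field_simps)
    qed
    \<comment> \<open>Each of the \<open>J\<close> terms carries weight \<open>d\<close> and two
      section errors below \<open>e\<close>. The summand \<open>1\<close> keeps the denominator
      positive when \<open>J = 0\<close>.\<close>
    define e where "e = \<epsilon> / (4 * (real J * d + 1))"
    have e: "0 < e" using that d by (simp add: e_def add_nonneg_pos)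
    have Je: "real J * d * (2 * e) \<le> \<epsilon> / 2"
    proof -
      have "0 < real J * d + 1" using d by (simp add: add_nonneg_pos)
      then have "(real J * d + 1) * (2 * e) = \<epsilon> / 2" by (simp add: e_def field_simps)
      moreover have "real J * d * (2 * e) \<le> (real J * d + 1) * (2 * e)"
        using e by (intro mult_right_mono) auto
      ultimately show ?thesis by simp
    qed
    \<comment> \<open>For \<open>j \<ge> 1\<close> the section at level \<open>real j * d\<close> is
      \<open>{x. real j * d \<le> f x}\<close>, and the one at the opposite level is
      \<open>{x. f x \<le> - (real j * d)}\<close>.\<close>
    define h where "h f x = (\<Sum>j=1..J. d *
      (indicator (S (real j * d) f) x - indicator (S (- (real j * d)) f) x))" for f and x :: 'a
    have h: "\<bar>f x - h f x\<bar> \<le> d" if "f \<in> F" for f x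
    proof -
      have "h f x = (\<Sum>j=1..J. d * (of_bool (real j * d \<le> f x) - of_bool (f x \<le> - (real j * d))))"
        unfolding h_def
      proof (rule sum.cong)
        fix j assume "j \<in> {1..J}"
        then have "0 < real j * d" using d by simp
        then show "d * (indicator (S (real j * d) f) x - indicator (S (- (real j * d)) f) x) =
          d * (of_bool (real j * d \<le> f x) - of_bool (f x \<le> - (real j * d)))"
          by (auto simp: S_def fun_graph_def indicator_def)
      qed simp
      then show ?thesis using grid_approx[OF d, of "f x" J] B[OF that, of x] J by simp
    qed
    \<comment> \<open>The levels depend on \<open>d\<close> and \<open>J\<close> but not on
      \<open>f\<close>, so finitely many almost sure statements cover the whole family.\<close>
    have "AE \<omega> in M. \<forall>s\<in>(\<lambda>j. real j * d) ` {1..J} \<union> (\<lambda>j. - (real j * d)) ` {1..J}.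
      \<forall>\<^sub>F n in sequentially. \<forall>f\<in>F.
        \<bar>?avg \<omega> n (indicator (S s f)) - ?E (indicator (S s f))\<bar> < e"
      using e by (intro AE_finite_allI sections) auto
    then show ?thesis
    proof eventually_elim
      case (elim \<omega>)
      then have "\<forall>\<^sub>F n in sequentially.
        \<forall>s\<in>(\<lambda>j. real j * d) ` {1..J} \<union> (\<lambda>j. - (real j * d)) ` {1..J}. \<forall>f\<in>F.
          \<bar>?avg \<omega> n (indicator (S s f)) - ?E (indicator (S s f))\<bar> < e"
        by (intro eventually_ball_finite) auto
      then show ?case
      proof eventually_elim
        case ev: (elim n)
        show ?case
        proof
          fix f assume f: "f \<in> F"
          have int: "integrable ?N (indicator (S s f) :: 'a \<Rightarrow> real)" for s
            using S[OF f, of s]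
            by (intro integrable_real_indicator) (auto simp: N.emeasure_eq_measure less_top)
          have int_h: "integrable ?N (h f)" unfolding h_def[abs_def]
            using int by (intro Bochner_Integration.integrable_sum integrable_mult_right
                Bochner_Integration.integrable_diff)
          have int_f: "integrable ?N f"
            using assms(2)[OF f] B[OF f] by (intro N.integrable_const_bound[of _ B]) auto
          have "\<bar>?avg \<omega> n f - ?avg \<omega> n (h f)\<bar> \<le> d"
          proof -
            have "\<bar>\<Sum>i<n. f (X i \<omega>) - h f (X i \<omega>)\<bar> \<le> (\<Sum>i<n. d)"
              using h[OF f] by (intro order_trans[OF sum_abs] sum_mono)
            then have "\<bar>\<Sum>i<n. f (X i \<omega>) - h f (X i \<omega>)\<bar> / real n \<le> real n * d / real n"
              by (intro divide_right_mono) auto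
            also have "\<dots> \<le> d" using d by (cases "n = 0") auto
            finally show ?thesis
              by (simp add: sum_subtractf flip: diff_divide_distrib)
          qed
          moreover have "\<bar>?E f - ?E (h f)\<bar> \<le> d"
          proof -
            have "\<bar>?E (\<lambda>x. f x - h f x)\<bar> \<le> ?E (\<lambda>x. \<bar>f x - h f x\<bar>)"
              by (rule integral_abs_bound)
            also have "\<dots> \<le> ?E (\<lambda>x. d)"
              using int_f int_h h[OF f] by (intro integral_mono) auto
            finally show ?thesis using int_f int_h N.prob_space by simp
          qed
          moreover have "\<bar>?avg \<omega> n (h f) - ?E (h f)\<bar> \<le> \<epsilon> / 2"
          proof -
            \<comment> \<open>The signed error of the section at level \<open>s\<close>; by
              linearity the error of \<open>h f\<close> is a combination of these.\<close>
            define D where "D s = ?avg \<omega> n (indicator (S s f)) - ?E (indicator (S s f))" for s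
            have "(\<Sum>i<n. h f (X i \<omega>)) = (\<Sum>j=1..J. d *
                ((\<Sum>i<n. indicator (S (real j * d) f) (X i \<omega>))
                  - (\<Sum>i<n. indicator (S (- (real j * d)) f) (X i \<omega>))))"
              unfolding h_def
              by (subst sum.swap) (simp only: sum_distrib_left sum_subtractf right_diff_distrib)
            then have avg_h: "?avg \<omega> n (h f) = (\<Sum>j=1..J. d * (?avg \<omega> n (indicator (S (real j * d) f))
                - ?avg \<omega> n (indicator (S (- (real j * d)) f))))"
              by (simp only: sum_divide_distrib[of _ "{1..J}"] times_divide_eq_right flip: diff_divide_distrib)
            have E_h: "?E (h f) = (\<Sum>j=1..J. d * (?E (indicator (S (real j * d) f))
                - ?E (indicator (S (- (real j * d)) f))))"
              unfolding h_def[abs_def]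
            proof (subst Bochner_Integration.integral_sum)
              show "integrable ?N (\<lambda>x. d * (indicator (S (real j * d) f) x
                  - indicator (S (- (real j * d)) f) x))" for j :: nat
                by (intro integrable_mult_right Bochner_Integration.integrable_diff int)
              show "(\<Sum>j=1..J. ?E (\<lambda>x. d * (indicator (S (real j * d) f) x
                  - indicator (S (- (real j * d)) f) x))) =
                (\<Sum>j=1..J. d * (?E (indicator (S (real j * d) f))
                  - ?E (indicator (S (- (real j * d)) f))))"
                by (simp only: integral_mult_right_zero Bochner_Integration.integral_diff[OF int int])
            qed
            have "?avg \<omega> n (h f) - ?E (h f) =
                (\<Sum>j=1..J. d * (D (real j * d) - D (- (real j * d))))"
              unfolding avg_h E_h D_def sum_subtractf[symmetric]
              by (intro sum.cong refl) algebra
            also have "\<bar>\<dots>\<bar> \<le> (\<Sum>j=1..J. d * (2 * e))"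
            proof (intro order_trans[OF sum_abs] sum_mono)
              fix j assume "j \<in> {1..J}"
              then have "\<bar>D (real j * d)\<bar> < e" "\<bar>D (- (real j * d))\<bar> < e"
                unfolding D_def by (intro ev[rule_format, OF _ f] UnI1 UnI2 imageI; assumption)+
              then have "\<bar>D (real j * d) - D (- (real j * d))\<bar> \<le> 2 * e" by linarith
              then show "\<bar>d * (D (real j * d) - D (- (real j * d)))\<bar> \<le> d * (2 * e)"
                using d by (simp add: abs_mult)
            qed
            also have "\<dots> \<le> \<epsilon> / 2" using Je by (simp add: mult.assoc)
            finally show ?thesis .
          qed
          ultimately show "\<bar>?avg \<omega> n f - ?E f\<bar> \<le> \<epsilon>" unfolding d_def by linarith
        qed
      qed
    qed
  qed
  \<comment> \<open>Tolerances \<open>1 / Suc j\<close> suffice and leave only countably many null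
    sets.\<close>
  then have "AE \<omega> in M. \<forall>j. \<forall>\<^sub>F n in sequentially. \<forall>f\<in>F. \<bar>?avg \<omega> n f - ?E f\<bar> \<le> 1 / Suc j"
    by (simp add: AE_all_countable)
  then show ?thesis
  proof eventually_elim
    case (elim \<omega>)
    show ?case
    proof (rule order_tendstoI)
      fix a :: ennreal assume "0 < a"
      \<comment> \<open>A \<open>b\<close> strictly below \<open>a\<close> is finite, hence a real
        number, and bounding the supremum by \<open>b\<close> keeps the inequality with
        \<open>a\<close> strict.\<close>
      then obtain b where b: "0 < b" "b < a" using dense by blast
      then obtain r where r: "b = ennreal r" "0 \<le> r" by (cases b) auto
      then have "0 < r" using b by simp
      then obtain j where j: "1 / Suc j < r" using nat_approx_posE by blast
      from elim[rule_format, of j]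
      show "\<forall>\<^sub>F n in sequentially. (SUP f\<in>F. ennreal \<bar>?avg \<omega> n f - ?E f\<bar>) < a"
      proof eventually_elim
        case (elim n)
        have "(SUP f\<in>F. ennreal \<bar>?avg \<omega> n f - ?E f\<bar>) \<le> b"
          unfolding r(1) by (intro SUP_least ennreal_leI) (use elim j in force)
        then show ?case using b(2) by (rule le_less_trans)
      qed
    qed simp
  qed
qed

end
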